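(* Let $\mathcal{A}$ be a (commutative) unique factorization domain that is a $\mathbb{C}$-algebra, and let $\sigma\neq\mathrm{id}$ be an endomorphism of $\mathcal{A}$. Then $$S^1\subseteq\mathcal{I}nn_\sigma(\mathcal{A})\subseteq S_1\subseteq\widetilde S_1 .$$
   Context: Algebras are associative unital $\mathbb{C}$-algebras, and endomorphisms are unital $\mathbb{C}$-algebra endomorphisms. A $\sigma$-derivation of $\mathcal{A}$ is a $\mathbb{C}$-linear map $D:\mathcal{A}\to\mathcal{A}$ with $D(ab)=\sigma(a)D(b)+D(a)b$ for all $a,b\in\mathcal{A}$; $\mathcal{D}_\sigma(\mathcal{A})$ is the set of all of them, a left $\mathcal{A}$-module via $(a\Delta)(r)=a\Delta(r)$. A $\sigma$-derivation is inner if it equals $r\mapsto p(r-\sigma(r))$ for some $p\in\mathcal{A}$; $\mathcal{I}nn_\sigma(\mathcal{A})$ is the set of inner ones. Fix $g$ a greatest common divisor of $\{r-\sigma(r) : r\in\mathcal{A}\}$ and let $\Delta=(\mathrm{id}-\sigma)/g$. It is known that $\mathcal{D}_\sigma(\mathcal{A})=\mathcal{A}\Delta$ is free of rank one over $\mathcal{A}$ with generator $\Delta$. The bracket on $\mathcal{D}_\sigma(\mathcal{A})=\mathcal{A}\Delta$ is the $\mathbb{C}$-bilinear product $$[a\Delta,b\Delta]_\sigma=(\sigma(a)\Delta)\circ(b\Delta)-(\sigma(b)\Delta)\circ(a\Delta)=\big(\sigma(a)\Delta(b)-\sigma(b)\Delta(a)\big)\Delta,\quad a,b\in\mathcal{A}.$$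 Define: - $S^1=\mathrm{Span}_{\mathbb{C}}\{[x,y]_\sigma : x,y\in\mathcal{I}nn_\sigma(\mathcal{A})\}$; - $\widetilde S_1=\{x\in\mathcal{D}_\sigma(\mathcal{A}) : [x,y]_\sigma\in\mathcal{I}nn_\sigma(\mathcal{A})\ \forall y\in S^1\}$; - $S_1=\{x\in\mathcal{D}_\sigma(\mathcal{A}) : [x,y]_\sigma\in S^1\ \forall y\in S^1\}$. *)

theory Defs
  imports Complex_Main "HOL-Computational_Algebra.Factorial_Ring" "HOL-Library.Function_Algebras"
begin

locale complex_algebra = vector_space scale
  for scale :: "complex \<Rightarrow> 'a::ring_1 \<Rightarrow> 'a" +
  assumes scale_mult_left: "scale c x * y = scale c (x * y)"
    and scale_mult_right: "x * scale c y = scale c (x * y)"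

definition algebra_endomorphism :: "(complex \<Rightarrow> 'a::ring_1 \<Rightarrow> 'a) \<Rightarrow> ('a \<Rightarrow> 'a) \<Rightarrow> bool" where
  "algebra_endomorphism scale \<sigma> \<longleftrightarrow>
     Vector_Spaces.linear scale scale \<sigma> \<and> \<sigma> 1 = 1 \<and> (\<forall>a b. \<sigma> (a * b) = \<sigma> a * \<sigma> b)"

text \<open>An arbitrary greatest common divisor of a set, as opposed to the normalized one that
  \<open>Gcd\<close> selects.\<close>

definition is_Gcd :: "'a::comm_semiring_1 \<Rightarrow> 'a set \<Rightarrow> bool" where
  "is_Gcd g X \<longleftrightarrow> (\<forall>x\<in>X. g dvd x) \<and> (\<forall>d. (\<forall>x\<in>X. d dvd x) \<longrightarrow> d dvd g)"

definition sigma_derivations :: "(complex \<Rightarrow> 'a::ring_1 \<Rightarrow> 'a) \<Rightarrow> ('a \<Rightarrow> 'a) \<Rightarrow> ('a \<Rightarrow> 'a) set" where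
  "sigma_derivations scale \<sigma> =
     {D. Vector_Spaces.linear scale scale D \<and> (\<forall>a b. D (a * b) = \<sigma> a * D b + D a * b)}"

definition inner_sigma_derivations :: "(complex \<Rightarrow> 'a::ring_1 \<Rightarrow> 'a) \<Rightarrow> ('a \<Rightarrow> 'a) \<Rightarrow> ('a \<Rightarrow> 'a) set" where
  "inner_sigma_derivations scale \<sigma> =
     {D \<in> sigma_derivations scale \<sigma>. \<exists>p. D = (\<lambda>r. p * (r - \<sigma> r))}"

text \<open>The division is exact when \<open>g\<close> is a greatest common divisor of the elements \<open>r - \<sigma> r\<close>.\<close>

definition Delta :: "('a::idom_divide \<Rightarrow> 'a) \<Rightarrow> 'a \<Rightarrow> 'a \<Rightarrow> 'a" where
  "Delta \<sigma> g = (\<lambda>r. (r - \<sigma> r) div g)"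

text \<open>The coefficient \<open>a\<close> of an element \<open>a \<Delta>\<close> of the free module \<open>A \<Delta>\<close>; unspecified for maps
  that are not multiples of \<open>\<Delta>\<close>.\<close>

definition Delta_coeff :: "('a::idom_divide \<Rightarrow> 'a) \<Rightarrow> 'a \<Rightarrow> ('a \<Rightarrow> 'a) \<Rightarrow> 'a" where
  "Delta_coeff \<sigma> g x = (THE a. x = (\<lambda>r. a * Delta \<sigma> g r))"

definition sigma_bracket ::
    "('a::idom_divide \<Rightarrow> 'a) \<Rightarrow> 'a \<Rightarrow> ('a \<Rightarrow> 'a) \<Rightarrow> ('a \<Rightarrow> 'a) \<Rightarrow> ('a \<Rightarrow> 'a)" where
  "sigma_bracket \<sigma> g x y =
     (let a = Delta_coeff \<sigma> g x; b = Delta_coeff \<sigma> g y; \<Delta> = Delta \<sigma> g in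
      (\<lambda>r. ((\<lambda>s. \<sigma> a * \<Delta> s) \<circ> (\<lambda>s. b * \<Delta> s)) r - ((\<lambda>s. \<sigma> b * \<Delta> s) \<circ> (\<lambda>s. a * \<Delta> s)) r))"

text \<open>The linear span is taken in the space of all maps with pointwise operations.\<close>

definition S_up :: "(complex \<Rightarrow> 'a::idom_divide \<Rightarrow> 'a) \<Rightarrow> ('a \<Rightarrow> 'a) \<Rightarrow> 'a \<Rightarrow> ('a \<Rightarrow> 'a) set" where
  "S_up scale \<sigma> g =
     module.span (\<lambda>c f r. scale c (f r))
       {sigma_bracket \<sigma> g x y | x y.
          x \<in> inner_sigma_derivations scale \<sigma> \<and> y \<in> inner_sigma_derivations scale \<sigma>}"

definition S_low_tilde :: "(complex \<Rightarrow> 'a::idom_divide \<Rightarrow> 'a) \<Rightarrow> ('a \<Rightarrow> 'a) \<Rightarrow> 'a \<Rightarrow> ('a \<Rightarrow> 'a) set" where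
  "S_low_tilde scale \<sigma> g =
     {x \<in> sigma_derivations scale \<sigma>.
        \<forall>y \<in> S_up scale \<sigma> g. sigma_bracket \<sigma> g x y \<in> inner_sigma_derivations scale \<sigma>}"

definition S_low :: "(complex \<Rightarrow> 'a::idom_divide \<Rightarrow> 'a) \<Rightarrow> ('a \<Rightarrow> 'a) \<Rightarrow> 'a \<Rightarrow> ('a \<Rightarrow> 'a) set" where
  "S_low scale \<sigma> g =
     {x \<in> sigma_derivations scale \<sigma>.
        \<forall>y \<in> S_up scale \<sigma> g. sigma_bracket \<sigma> g x y \<in> S_up scale \<sigma> g}"

lemma (in complex_algebra) vector_space_maps:
  "vector_space (\<lambda>c (f :: 'b \<Rightarrow> 'a) r. scale c (f r))"
  by unfold_locales (auto simp: fun_eq_iff scale_right_distrib scale_left_distrib)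

context
  fixes scale :: "complex \<Rightarrow> 'a::{idom_divide, factorial_semiring} \<Rightarrow> 'a" and \<sigma> :: "'a \<Rightarrow> 'a" and g :: 'a
  assumes alg: "complex_algebra scale" and endo: "algebra_endomorphism scale \<sigma>"
    and neq: "\<sigma> \<noteq> id" and gcd: "is_Gcd g (range (\<lambda>r. r - \<sigma> r))"
begin

lemma g_nonzero: "g \<noteq> 0"
  using neq gcd by (force simp: is_Gcd_def fun_eq_iff)

lemma g_mult_Delta: "g * Delta \<sigma> g r = r - \<sigma> r"
  using gcd by (auto simp: is_Gcd_def Delta_def)

lemma Delta_nonzero: "\<exists>r. Delta \<sigma> g r \<noteq> 0"
  using neq g_mult_Delta by (metis eq_id_iff eq_iff_diff_eq_0 mult_zero_right)

lemma Delta_coeff_eq: "Delta_coeff \<sigma> g (\<lambda>r. a * Delta \<sigma> g r) = a"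
  unfolding Delta_coeff_def using Delta_nonzero by (auto simp: fun_eq_iff)

lemma Delta_mult: "Delta \<sigma> g (a * b) = \<sigma> a * Delta \<sigma> g b + Delta \<sigma> g a * b"
proof -
  have "g * Delta \<sigma> g (a * b) = a * b - \<sigma> a * \<sigma> b"
    using endo by (simp add: g_mult_Delta algebra_endomorphism_def)
  also have "\<dots> = \<sigma> a * (g * Delta \<sigma> g b) + (g * Delta \<sigma> g a) * b"
    by (simp add: g_mult_Delta algebra_simps)
  also have "\<dots> = g * (\<sigma> a * Delta \<sigma> g b + Delta \<sigma> g a * b)"
    by (simp add: algebra_simps)
  finally show ?thesis using g_nonzero by simp
qed

lemma sigma_bracket_eq:
  "sigma_bracket \<sigma> g (\<lambda>r. a * Delta \<sigma> g r) (\<lambda>r. b * Delta \<sigma> g r) =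
     (\<lambda>r. (\<sigma> a * Delta \<sigma> g b - \<sigma> b * Delta \<sigma> g a) * Delta \<sigma> g r)"
  unfolding sigma_bracket_def Let_def Delta_coeff_eq comp_def Delta_mult by (simp add: algebra_simps)

lemma dvd_if_dvd_Delta_mult:
  assumes "\<And>b. c dvd Delta \<sigma> g b * d"
  shows "c dvd d"
  using assms
proof (induction c arbitrary: d rule: prime_divisors_induct)
  case zero
  then show ?case using Delta_nonzero by auto
next
  case (unit c)
  then show ?case by (simp add: unit_imp_dvd)
next
  case (factor p c)
  have "\<exists>b. \<not> p dvd Delta \<sigma> g b"
  proof (rule ccontr)
    assume "\<not> ?thesis"
    then have "g * p dvd r - \<sigma> r" for r
      unfolding g_mult_Delta[symmetric] by (intro mult_dvd_mono dvd_refl) blast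
    then have "g * p dvd g" using gcd by (auto simp: is_Gcd_def)
    then have "p dvd 1" using g_nonzero by simp
    then show False using factor.hyps by (simp add: prime_def prime_elem_def)
  qed
  then obtain b where b: "\<not> p dvd Delta \<sigma> g b" by blast
  have "p dvd Delta \<sigma> g b * d" using factor.prems by (rule dvd_mult_left)
  then have "p dvd d" using b factor.hyps by (simp add: prime_dvd_mult_iff)
  then obtain e where e: "d = p * e" ..
  have "c dvd Delta \<sigma> g b * e" for b
    using factor.prems[of b] factor.hyps by (auto simp: e mult.left_commute)
  then have "c dvd e" by (rule factor.IH)
  then show ?case by (simp add: e)
qed

text \<open>Every \<open>\<sigma>\<close>-derivation is a multiple of \<open>\<Delta>\<close>, so together with \<open>Delta_coeff_eq\<close> the
  coefficients in \<open>sigma_bracket\<close> are determined on all \<open>\<sigma>\<close>-derivations.\<close>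

lemma sigma_derivations_eq:
  "sigma_derivations scale \<sigma> = range (\<lambda>a r. a * Delta \<sigma> g r)"
proof (intro equalityI subsetI)
  interpret complex_algebra scale by (rule alg)
  fix D assume D: "D \<in> sigma_derivations scale \<sigma>"
  have comm: "Delta \<sigma> g a * D b = Delta \<sigma> g b * D a" for a b
  proof -
    have "D (x * y) = \<sigma> x * D y + D x * y" for x y
      using D by (simp add: sigma_derivations_def)
    from this[of a b] this[of b a] have "\<sigma> a * D b + D a * b = \<sigma> b * D a + D b * a"
      by (simp add: mult.commute)
    then have "(a - \<sigma> a) * D b = (b - \<sigma> b) * D a"
      by algebra
    then have "g * (Delta \<sigma> g a * D b) = g * (Delta \<sigma> g b * D a)"
      by (simp only: mult.assoc flip: g_mult_Delta)
    then show ?thesis using g_nonzero by simp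
  qed
  obtain a where a: "Delta \<sigma> g a \<noteq> 0" using Delta_nonzero by blast
  have "Delta \<sigma> g a dvd D a"
    by (rule dvd_if_dvd_Delta_mult) (metis comm dvd_triv_left)
  then obtain e where e: "D a = Delta \<sigma> g a * e" ..
  have "D r = e * Delta \<sigma> g r" for r
  proof -
    have "Delta \<sigma> g a * D r = Delta \<sigma> g a * (e * Delta \<sigma> g r)"
      unfolding comm[of a r] e by (simp add: mult_ac)
    then show ?thesis using a by simp
  qed
  then show "D \<in> range (\<lambda>a r. a * Delta \<sigma> g r)" by auto
next
  interpret complex_algebra scale by (rule alg)
  have lin: "Vector_Spaces.linear scale scale \<sigma>"
    using endo by (simp add: algebra_endomorphism_def)
  have \<sigma>_add: "\<sigma> (x + y) = \<sigma> x + \<sigma> y" and \<sigma>_scale: "\<sigma> (scale c x) = scale c (\<sigma> x)" for c x y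
    using lin by (simp_all add: module_hom_iff flip: module_hom_iff_linear)
  have add: "Delta \<sigma> g (x + y) = Delta \<sigma> g x + Delta \<sigma> g y" for x y
  proof -
    have "g * Delta \<sigma> g (x + y) = g * (Delta \<sigma> g x + Delta \<sigma> g y)"
      unfolding distrib_left g_mult_Delta by (simp add: \<sigma>_add)
    then show ?thesis using g_nonzero by simp
  qed
  have sc: "Delta \<sigma> g (scale c x) = scale c (Delta \<sigma> g x)" for c x
  proof -
    have "g * Delta \<sigma> g (scale c x) = g * scale c (Delta \<sigma> g x)"
      unfolding scale_mult_right g_mult_Delta by (simp add: \<sigma>_scale scale_right_diff_distrib)
    then show ?thesis using g_nonzero by simp
  qed
  fix D assume "D \<in> range (\<lambda>a r. a * Delta \<sigma> g r)"
  then obtain a where D: "D = (\<lambda>r. a * Delta \<sigma> g r)" by auto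
  show "D \<in> sigma_derivations scale \<sigma>"
    unfolding sigma_derivations_def mem_Collect_eq
  proof
    show "Vector_Spaces.linear scale scale D"
      using module_axioms
      by (simp add: module_hom_iff D add sc distrib_left scale_mult_right flip: module_hom_iff_linear)
    show "\<forall>a b. D (a * b) = \<sigma> a * D b + D a * b"
      by (simp add: D Delta_mult algebra_simps)
  qed
qed

end

end

theory Submission
  imports Defs
begin

text \<open>Since \<open>r - \<sigma> r = g * \<Delta> r\<close>, the inner derivations are exactly the \<open>a \<Delta>\<close> with \<open>g dvd a\<close>.
  The same identity says that \<open>\<sigma>\<close> is the identity modulo \<open>g\<close>, so \<open>\<sigma>\<close> maps the ideal
  generated by \<open>g\<close> into itself. Hence, if \<open>g\<close> divides \<open>a\<close> and \<open>b\<close>, it divides the coefficient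
  \<open>\<sigma> a * \<Delta> b - \<sigma> b * \<Delta> a\<close> of the bracket of \<open>a \<Delta>\<close> and \<open>b \<Delta>\<close>: the inner derivations are closed
  under the bracket (\<open>sigma_bracket_inner\<close>). They also form a subspace, so they contain the
  span \<open>S\<^sup>1\<close> of their brackets. The other two inclusions follow from this one: for inner \<open>x\<close> and
  \<open>y \<in> S\<^sup>1\<close> the bracket of \<open>x\<close> and \<open>y\<close> is one of two inner derivations, hence a generator of
  \<open>S\<^sup>1\<close>, and the conditions defining \<open>S\<^sub>1\<close> and its tilde variant differ only in
  asking the brackets to lie in \<open>S\<^sup>1\<close> or in the larger set of inner derivations.\<close>

context
  fixes scale :: "complex \<Rightarrow> 'a::{idom_divide, factorial_semiring} \<Rightarrow> 'a" and \<sigma> :: "'a \<Rightarrow> 'a" and g :: 'a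
  assumes alg: "complex_algebra scale" and endo: "algebra_endomorphism scale \<sigma>"
    and neq: "\<sigma> \<noteq> id" and gcd: "is_Gcd g (range (\<lambda>r. r - \<sigma> r))"
begin

text \<open>The map with parameter \<open>p\<close> has \<open>\<Delta>\<close>-coefficient \<open>g * p\<close>, which turns membership in the
  set of inner derivations into a divisibility condition on the coefficient.\<close>

lemma inner_sigma_derivations_eq:
  "inner_sigma_derivations scale \<sigma> = {\<lambda>r. a * Delta \<sigma> g r | a. g dvd a}"
proof -
  have "(\<lambda>r. p * (r - \<sigma> r)) = (\<lambda>r. (g * p) * Delta \<sigma> g r)" for p
    unfolding g_mult_Delta[OF alg endo neq gcd, symmetric] by (simp add: mult_ac)
  then show ?thesis
    unfolding inner_sigma_derivations_def sigma_derivations_eq[OF alg endo neq gcd] dvd_def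
    by auto
qed

lemma subspace_inner_sigma_derivations:
  "module.subspace (\<lambda>c f r. scale c (f r)) (inner_sigma_derivations scale \<sigma>)"
proof -
  interpret complex_algebra scale by (rule alg)
  interpret maps: vector_space "\<lambda>c (f :: 'a \<Rightarrow> 'a) r. scale c (f r)"
    by (rule vector_space_maps)
  show ?thesis
    unfolding inner_sigma_derivations_eq
  proof (rule maps.subspaceI)
    show "0 \<in> {\<lambda>r. a * Delta \<sigma> g r | a. g dvd a}"
      by (auto simp: fun_eq_iff intro!: exI[of _ 0])
  next
    fix x y assume "x \<in> {\<lambda>r. a * Delta \<sigma> g r | a. g dvd a}" "y \<in> {\<lambda>r. a * Delta \<sigma> g r | a. g dvd a}"
    then obtain a b where "g dvd a" "g dvd b"
      and "x = (\<lambda>r. a * Delta \<sigma> g r)" "y = (\<lambda>r. b * Delta \<sigma> g r)" by blast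
    then show "x + y \<in> {\<lambda>r. a * Delta \<sigma> g r | a. g dvd a}"
      by (auto simp: fun_eq_iff distrib_right intro!: exI[of _ "a + b"])
  next
    fix c x assume "x \<in> {\<lambda>r. a * Delta \<sigma> g r | a. g dvd a}"
    then obtain p where "x = (\<lambda>r. (g * p) * Delta \<sigma> g r)" by (auto elim!: dvdE)
    then have "(\<lambda>r. scale c (x r)) = (\<lambda>r. (g * scale c p) * Delta \<sigma> g r)"
      by (simp add: scale_mult_left scale_mult_right)
    then show "(\<lambda>r. scale c (x r)) \<in> {\<lambda>r. a * Delta \<sigma> g r | a. g dvd a}" by auto
  qed
qed

text \<open>This holds because \<open>\<sigma> a\<close> and \<open>a\<close> are congruent modulo \<open>g\<close>. It is what makes the twist by \<open>\<sigma>\<close>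
  in the bracket harmless.\<close>

lemma gcd_dvd_endomorphism:
  assumes "g dvd a"
  shows "g dvd \<sigma> a"
proof -
  have "\<sigma> a = a - g * Delta \<sigma> g a"
    by (simp add: g_mult_Delta[OF alg endo neq gcd])
  then show ?thesis using assms by simp
qed

text \<open>Each summand of the bracket's coefficient contains \<open>\<sigma> a\<close> or \<open>\<sigma> b\<close> as a factor, and \<open>g\<close>
  divides both; the values of \<open>\<Delta>\<close> on \<open>a\<close> and \<open>b\<close> do not matter.\<close>

lemma sigma_bracket_inner:
  assumes "x \<in> inner_sigma_derivations scale \<sigma>" and "y \<in> inner_sigma_derivations scale \<sigma>"
  shows "sigma_bracket \<sigma> g x y \<in> inner_sigma_derivations scale \<sigma>"
proof -
  obtain a b where ab: "g dvd a" "g dvd b"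
    and xy: "x = (\<lambda>r. a * Delta \<sigma> g r)" "y = (\<lambda>r. b * Delta \<sigma> g r)"
    using assms unfolding inner_sigma_derivations_eq by blast
  have "g dvd \<sigma> a * Delta \<sigma> g b - \<sigma> b * Delta \<sigma> g a"
    using ab by (intro dvd_diff dvd_mult2 gcd_dvd_endomorphism)
  then show ?thesis
    unfolding xy sigma_bracket_eq[OF alg endo neq gcd] inner_sigma_derivations_eq by blast
qed

lemma S_up_subset_inner: "S_up scale \<sigma> g \<subseteq> inner_sigma_derivations scale \<sigma>"
proof -
  interpret complex_algebra scale by (rule alg)
  interpret maps: vector_space "\<lambda>c (f :: 'a \<Rightarrow> 'a) r. scale c (f r)"
    by (rule vector_space_maps)
  show ?thesis
    unfolding S_up_def
    by (rule maps.span_minimal) (auto intro: sigma_bracket_inner subspace_inner_sigma_derivations)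
qed

lemma sigma_bracket_in_S_up:
  assumes "x \<in> inner_sigma_derivations scale \<sigma>" and "y \<in> inner_sigma_derivations scale \<sigma>"
  shows "sigma_bracket \<sigma> g x y \<in> S_up scale \<sigma> g"
proof -
  interpret complex_algebra scale by (rule alg)
  interpret maps: vector_space "\<lambda>c (f :: 'a \<Rightarrow> 'a) r. scale c (f r)"
    by (rule vector_space_maps)
  show ?thesis
    unfolding S_up_def using assms by (intro maps.span_base) blast
qed

end

theorem proposition3p8:
  fixes scale :: "complex \<Rightarrow> 'a::{idom_divide, factorial_semiring} \<Rightarrow> 'a"
    and \<sigma> :: "'a \<Rightarrow> 'a" and g :: 'a
  assumes "complex_algebra scale"
    and "algebra_endomorphism scale \<sigma>"
    and "\<sigma> \<noteq> id"
    and "is_Gcd g (range (\<lambda>r. r - \<sigma> r))"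
  shows "S_up scale \<sigma> g \<subseteq> inner_sigma_derivations scale \<sigma>
    \<and> inner_sigma_derivations scale \<sigma> \<subseteq> S_low scale \<sigma> g
    \<and> S_low scale \<sigma> g \<subseteq> S_low_tilde scale \<sigma> g"
proof (intro conjI)
  show S_up: "S_up scale \<sigma> g \<subseteq> inner_sigma_derivations scale \<sigma>"
    by (rule S_up_subset_inner[OF assms])
  show "inner_sigma_derivations scale \<sigma> \<subseteq> S_low scale \<sigma> g"
  proof
    fix x assume x: "x \<in> inner_sigma_derivations scale \<sigma>"
    then have "x \<in> sigma_derivations scale \<sigma>"
      by (simp add: inner_sigma_derivations_def)
    moreover have "sigma_bracket \<sigma> g x y \<in> S_up scale \<sigma> g" if "y \<in> S_up scale \<sigma> g" for y
      using x S_up that by (blast intro: sigma_bracket_in_S_up[OF assms])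
    ultimately show "x \<in> S_low scale \<sigma> g" by (simp add: S_low_def)
  qed
  show "S_low scale \<sigma> g \<subseteq> S_low_tilde scale \<sigma> g"
    using S_up unfolding S_low_def S_low_tilde_def by blast
qed

end
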